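(* Let $\mathcal T$ be an infinite, locally finite, rooted tree which is uniformly transient, with critical value $\lambda_c=\lambda_c(\mathcal T)$. Then the effective conductance $\lambda\mapsto\mathcal C(\lambda,\mathcal T)$ is left continuous on $(\lambda_c,+\infty)$.
   Context: For $\lambda>0$ and a rooted tree with root $o$, $RW_\lambda$ is the Markov chain on the vertices which, at a vertex $x\ne o$ with $k$ children, jumps to the parent of $x$ with probability $1/(1+k\lambda)$ and to each child with probability $\lambda/(1+k\lambda)$; from the root it jumps to a uniformly chosen child. The critical value $\lambda_c(\mathcal T)$ is such that $RW_\lambda$ on $\mathcal T$ is recurrent for $\lambda<\lambda_c(\mathcal T)$ and transient for $\lambda>\lambda_c(\mathcal T)$. Effective conductance: give each edge $(x,y)$, with $x$ the parent of $y$, the conductance $\lambda^{|x|}$, where $|x|$ is the distance from $x$ to the root. Then $\mathcal C(\lambda,\mathcal T)=\pi(o)\,\mathbb P(RW_\lambda\text{ started at }o\text{ never returns to }o)$, where $\pi(o)$ is the sum of conductances of edges at the root (the number of children of $o$). For a vertex $\nu$, let $\mathcal T^\nu$ be the subtree of $\mathcal T$ formed by $\nu$ and its descendants, rooted at $\nu$, and let $(X^\nu_n)$ be the walk $RW_\lambda$ on $\mathcal T^\nu$ started at $\nu$ (if $\nu$ has no child, the walk stays at $\nu$). The tree $\mathcal T$ is uniformly transient if for every $\lambda>\lambda_c$ there is $\alpha_\lambda>0$ such that for every vertex $\nu$ of $\mathcal T$, $\mathbb P(\forall n>0,\ X^\nu_n\ne\nu)\ge\alpha_\lambda$. *)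

theory Defs
  imports "HOL-Probability.Probability"
begin

section \<open>Rooted trees\<close>

text \<open>Edges are pairs (parent, child).\<close>

record 'v rtree =
  verts :: "'v set"
  edges :: "('v \<times> 'v) set"
  root :: 'v

definition rooted_tree :: "'v rtree \<Rightarrow> bool" where
  "rooted_tree T \<longleftrightarrow>
     root T \<in> verts T \<and>
     edges T \<subseteq> verts T \<times> verts T \<and>
     (\<forall>x. (x, root T) \<notin> edges T) \<and>
     (\<forall>y\<in>verts T - {root T}. \<exists>!x. (x, y) \<in> edges T) \<and>
     (\<forall>y\<in>verts T. (root T, y) \<in> (edges T)\<^sup>*)"

definition children :: "'v rtree \<Rightarrow> 'v \<Rightarrow> 'v set" where
  "children T x = {y. (x, y) \<in> edges T}"

definition locally_finite :: "'v rtree \<Rightarrow> bool" where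
  "locally_finite T \<longleftrightarrow> (\<forall>x\<in>verts T. finite (children T x))"

text \<open>Distance to the root.\<close>

definition depth :: "'v rtree \<Rightarrow> 'v \<Rightarrow> nat" where
  "depth T x = (LEAST n. (root T, x) \<in> edges T ^^ n)"

definition descendants :: "'v rtree \<Rightarrow> 'v \<Rightarrow> 'v set" where
  "descendants T v = {y. (v, y) \<in> (edges T)\<^sup>*}"

definition subtree :: "'v rtree \<Rightarrow> 'v \<Rightarrow> 'v rtree" where
  "subtree T v =
     \<lparr>verts = descendants T v,
      edges = edges T \<inter> descendants T v \<times> descendants T v,
      root = v\<rparr>"


section \<open>Path space of a Markov chain\<close>

text \<open>
  The law on \<^typ>\<open>nat \<Rightarrow> 'v\<close> of the Markov chain with transition kernel \<open>K\<close> started at \<open>x\<close>,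
  obtained from the Ionescu-Tulcea theorem. It is characterised by the
  cylinder probabilities in \<open>markov_law_cylinder\<close> below.
\<close>

definition path_kernel :: "('v \<Rightarrow> 'v pmf) \<Rightarrow> 'v \<Rightarrow> nat \<Rightarrow> (nat \<Rightarrow> 'v) \<Rightarrow> 'v measure" where
  "path_kernel K x n \<omega> =
     measure_pmf (case n of 0 \<Rightarrow> return_pmf x | Suc m \<Rightarrow> K (\<omega> m))"

lemma measurable_path_kernel:
  "path_kernel K x n \<in>
     measurable (PiM {0..<n} (\<lambda>_. count_space UNIV)) (subprob_algebra (count_space UNIV))"
proof (cases n)
  case 0
  then show ?thesis
    by (simp add: path_kernel_def[abs_def] space_subprob_algebra measure_pmf.subprob_space_axioms)
next
  case (Suc m)
  have 1: "(\<lambda>\<omega>. \<omega> m) \<in> measurable (PiM {0..<Suc m} (\<lambda>_. count_space UNIV)) (count_space (UNIV :: 'v set))"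
    by (intro measurable_component_singleton) auto
  have 2: "(\<lambda>y. measure_pmf (K y)) \<in> measurable (count_space UNIV) (subprob_algebra (count_space UNIV))"
    by (simp add: space_subprob_algebra measure_pmf.subprob_space_axioms)
  show ?thesis
    unfolding path_kernel_def[abs_def] Suc nat.case
    by (rule measurable_compose[OF 1 2])
qed

interpretation markov: Ionescu_Tulcea "path_kernel K x" "\<lambda>_. count_space UNIV" for K x
  proof (rule Ionescu_Tulcea.intro)
  show "path_kernel K x i \<in>
      measurable (PiM {0..<i} (\<lambda>_. count_space UNIV)) (subprob_algebra (count_space UNIV))" for i
    by (rule measurable_path_kernel)
  show "prob_space (path_kernel K x i \<omega>)" for i \<omega>
    unfolding path_kernel_def by (rule measure_pmf.prob_space_axioms)
qed

definition markov_law :: "('v \<Rightarrow> 'v pmf) \<Rightarrow> 'v \<Rightarrow> (nat \<Rightarrow> 'v) measure" where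
  "markov_law K x = markov.PF.lim K x"

lemma sets_markov_law [measurable_cong]:
  "sets (markov_law K x) = sets (PiM UNIV (\<lambda>_. count_space UNIV))"
  by (simp add: markov_law_def)

lemma space_markov_law [simp]: "space (markov_law K x) = UNIV"
  using sets_eq_imp_space_eq[OF sets_markov_law, of K x] by (simp only: space_PiM space_count_space PiE_UNIV)

lemma emeasure_markov_C:
  "emeasure (markov.C K x 0 n (\<lambda>_. undefined)) (PiE {0..<n} (\<lambda>i. {w i})) =
     (\<Prod>i<n. ennreal (pmf (case i of 0 \<Rightarrow> return_pmf x | Suc m \<Rightarrow> K (w m)) (w i)))"
proof (induction n)
  case 0
  have "(\<lambda>_. undefined) \<in> space (PiM {} (\<lambda>_::nat. count_space (UNIV :: 'v set)))"
    by (simp add: space_PiM)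
  then show ?case
    by (simp add: emeasure_return PiM_empty)
next
  case (Suc n)
  let ?M = "\<lambda>n::nat. PiM {0..<n} (\<lambda>_. count_space (UNIV :: 'v set))"
  let ?A = "\<lambda>n::nat. PiE {0..<n} (\<lambda>i. {w i})"
  let ?C = "markov.C K x 0 n (\<lambda>_. undefined)"
  let ?p = "ennreal (pmf (case n of 0 \<Rightarrow> return_pmf x | Suc m \<Rightarrow> K (w m)) (w n))"
  have und: "(\<lambda>_. undefined) \<in> space (?M 0)"
    by (simp add: space_PiM)
  have A: "?A m \<in> sets (?M m)" for m
    by (intro sets_PiM_I_finite) auto
  have spC: "space ?C = space (?M n)"
    using markov.space_C[OF und, of K x n] by simp
  have step: "emeasure (markov.eP K x n \<omega>) (?A (Suc n)) = ?p * indicator (?A n) \<omega>"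
    if "\<omega> \<in> space (?M n)" for \<omega>
  proof -
    have "(\<lambda>y. fun_upd \<omega> n y) -` ?A (Suc n) = (if \<omega> \<in> ?A n then {w n} else {})"
      using that by (auto simp: PiE_iff space_PiM extensional_def less_Suc_eq fun_eq_iff split: if_splits)
    moreover have "path_kernel K x n \<omega> {w n} = ?p" if "\<omega> \<in> ?A n"
      using that by (auto simp: path_kernel_def emeasure_pmf_single PiE_iff split: nat.split)
    ultimately show ?thesis
      using markov.emeasure_eP[OF that A] by (auto simp: indicator_def)
  qed
  have "emeasure (markov.C K x 0 (Suc n) (\<lambda>_. undefined)) (?A (Suc n)) =
        (\<integral>\<^sup>+\<omega>. emeasure (markov.eP K x n \<omega>) (?A (Suc n)) \<partial>?C)"
    unfolding markov.C.simps add_0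
  proof (rule emeasure_bind)
    show "space ?C \<noteq> {}" by (simp add: spC space_PiM_empty_iff)
    show "markov.eP K x n \<in> measurable ?C (subprob_algebra (?M (Suc n)))"
      using markov.measurable_eP[of K x n] markov.sets_C[OF und, of K x n]
      by (simp cong: measurable_cong_sets)
    show "?A (Suc n) \<in> sets (?M (Suc n))" by (rule A)
  qed
  also have "\<dots> = (\<integral>\<^sup>+\<omega>. ?p * indicator (?A n) \<omega> \<partial>?C)"
    by (intro nn_integral_cong step) (simp add: spC)
  also have "\<dots> = ?p * emeasure ?C (?A n)"
    using A[of n] markov.sets_C[OF und, of K x n] by (intro nn_integral_cmult_indicator) simp
  finally show ?case
    by (simp add: Suc.IH mult.commute)
qed

lemma prob_space_markov_law: "prob_space (markov_law K x)"
proof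
  let ?M = "\<lambda>_. count_space (UNIV :: 'a set)"
  interpret E: prob_space "markov.CI K x {}"
    by (rule markov.PF.prob_space_P) auto
  have sp: "space (markov.CI K x {}) = space (PiM {} ?M)"
    by (rule markov.PF.space_P) auto
  have "emeasure (markov.PF.lim K x) (markov.PF.emb UNIV {} (space (PiM {} ?M))) =
        emeasure (markov.CI K x {}) (space (PiM {} ?M))"
    by (rule markov.lim) auto
  also have "\<dots> = 1"
    using E.emeasure_space_1 unfolding sp .
  finally have "emeasure (markov_law K x) (markov.PF.emb UNIV {} (space (PiM {} ?M))) = 1"
    by (simp only: markov_law_def)
  moreover have "markov.PF.emb UNIV {} (space (PiM {} ?M)) = UNIV"
    by (auto simp: prod_emb_def space_PiM)
  ultimately show "emeasure (markov_law K x) (space (markov_law K x)) = 1"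
    by simp
qed

lemma markov_law_cylinder:
  "measure (markov_law K x) {\<omega>. \<forall>i\<le>n. \<omega> i = w i} =
     of_bool (w 0 = x) * (\<Prod>i<n. pmf (K (w i)) (w (Suc i)))"
proof -
  let ?A = "PiE {0..<Suc n} (\<lambda>i. {w i})"
  have A: "?A \<in> sets (PiM {0..<Suc n} (\<lambda>_. count_space UNIV))"
    by (intro sets_PiM_I_finite) auto
  have "{\<omega>. \<forall>i\<le>n. \<omega> i = w i} = markov.PF.emb UNIV {0..<Suc n} ?A"
    by (auto simp: prod_emb_def PiE_iff space_PiM less_Suc_eq_le)
  then have "emeasure (markov_law K x) {\<omega>. \<forall>i\<le>n. \<omega> i = w i} = emeasure (markov.CI K x {0..<Suc n}) ?A"
    using markov.lim[OF _ A, of K x] by (simp add: markov_law_def)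
  also have "\<dots> = emeasure (markov.C K x 0 (Suc n) (\<lambda>_. undefined)) ?A"
    using markov.emeasure_CI[OF subset_refl A, of K x] sets.sets_into_space[OF A]
    by (simp add: prod_emb_id[OF sets.sets_into_space[OF A, unfolded space_PiM]] del: markov.C.simps)
  also have "\<dots> = (\<Prod>i<Suc n. ennreal (pmf (case i of 0 \<Rightarrow> return_pmf x | Suc m \<Rightarrow> K (w m)) (w i)))"
    by (rule emeasure_markov_C)
  also have "\<dots> = ennreal (of_bool (w 0 = x) * (\<Prod>i<n. pmf (K (w i)) (w (Suc i))))"
    by (subst prod.lessThan_Suc_shift) (auto simp: prod_ennreal pmf_nonneg indicator_def)
  finally show ?thesis
    by (simp add: measure_def prod_nonneg)
qed

section \<open>The walk\<close>

definition rw_prob :: "'v rtree \<Rightarrow> real \<Rightarrow> 'v \<Rightarrow> 'v \<Rightarrow> real" where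
  "rw_prob T lam x y =
     (let k = real (card (children T x)) in
      if x = root T then
        (if children T x \<noteq> {} then (if y \<in> children T x then 1 / k else 0)
         else (if y = x then 1 else 0))
      else if (y, x) \<in> edges T then 1 / (1 + k * lam)
      else if y \<in> children T x then lam / (1 + k * lam)
      else 0)"

text \<open>
  \<^const>\<open>embed_pmf\<close> is only specified on functions that are probability mass functions;
  \<open>pmf_rw_step\<close> below shows that this is the case for \<open>lam > 0\<close> at every vertex of a
  locally finite rooted tree.
\<close>

definition rw_step :: "'v rtree \<Rightarrow> real \<Rightarrow> 'v \<Rightarrow> 'v pmf" where
  "rw_step T lam x = embed_pmf (rw_prob T lam x)"

lemma rooted_tree_no_2cycle:
  assumes T: "rooted_tree T" and e: "(x, y) \<in> edges T" "(y, x) \<in> edges T"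
  shows False
proof -
  have *: "v \<noteq> x \<and> v \<noteq> y" if "(root T, v) \<in> (edges T)\<^sup>*" for v
    using that
  proof (induction rule: rtrancl_induct)
    case base
    show ?case using T e by (auto simp: rooted_tree_def)
  next
    case (step u v)
    have "v \<in> verts T - {root T}"
      using T step.hyps(2) by (auto simp: rooted_tree_def)
    then have u: "\<exists>!p. (p, v) \<in> edges T"
      using T by (simp add: rooted_tree_def)
    show ?case using u step e by blast
  qed
  have "x \<in> verts T" using T e by (auto simp: rooted_tree_def)
  then have "(root T, x) \<in> (edges T)\<^sup>*" using T by (simp add: rooted_tree_def)
  then show False using * by blast
qed

lemma pmf_rw_step:
  assumes T: "rooted_tree T" and fin: "locally_finite T" and x: "x \<in> verts T" and l: "lam > 0"
  shows "pmf (rw_step T lam x) y = rw_prob T lam x y"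
proof -
  let ?k = "real (card (children T x))"
  have finc: "finite (children T x)" using fin x by (auto simp: locally_finite_def)
  have pos: "1 + ?k * lam > 0" using l by (simp add: add_pos_nonneg)
  have nn: "0 \<le> rw_prob T lam x y" for y
    using l by (auto simp: rw_prob_def Let_def)
  have "\<exists>S. finite S \<and> {y. rw_prob T lam x y \<noteq> 0} \<subseteq> S \<and> (\<Sum>y\<in>S. rw_prob T lam x y) = 1"
  proof (cases "x = root T")
    case True
    show ?thesis
    proof (cases "children T x = {}")
      case True
      then show ?thesis using \<open>x = root T\<close>
        by (intro exI[of _ "{x}"]) (auto simp: rw_prob_def)
    next
      case False
      then show ?thesis using \<open>x = root T\<close> finc
        by (intro exI[of _ "children T x"]) (auto simp: rw_prob_def Let_def split: if_splits)
    qed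
  next
    case False
    then obtain p where p: "(p, x) \<in> edges T" "\<And>q. (q, x) \<in> edges T \<longleftrightarrow> q = p"
      using T x unfolding rooted_tree_def by blast
    have pc: "p \<notin> children T x"
      using rooted_tree_no_2cycle[OF T p(1)] by (auto simp: children_def)
    have "(\<Sum>y\<in>children T x. rw_prob T lam x y) = (\<Sum>y\<in>children T x. lam / (1 + ?k * lam))"
      using pc False p by (intro sum.cong) (auto simp: rw_prob_def Let_def)
    moreover have "rw_prob T lam x p = 1 / (1 + ?k * lam)"
      using False p by (simp add: rw_prob_def)
    ultimately have "(\<Sum>y\<in>insert p (children T x). rw_prob T lam x y) =
          1 / (1 + ?k * lam) + (\<Sum>y\<in>children T x. lam / (1 + ?k * lam))"
      using pc finc by simp
    also have "\<dots> = 1" using pos by (simp add: field_simps)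
    finally show ?thesis using finc False p
      by (intro exI[of _ "insert p (children T x)"]) (auto simp: rw_prob_def Let_def split: if_splits)
  qed
  then obtain S where S: "finite S" "{y. rw_prob T lam x y \<noteq> 0} \<subseteq> S" "(\<Sum>y\<in>S. rw_prob T lam x y) = 1"
    by blast
  have z: "rw_prob T lam x y = 0" if "y \<notin> S" for y
    using S(2) that by blast
  have "(\<integral>\<^sup>+y. ennreal (rw_prob T lam x y) \<partial>count_space UNIV) = (\<Sum>y\<in>S. ennreal (rw_prob T lam x y))"
    using S(1) by (intro nn_integral_count_space') (simp_all add: z)
  also have "\<dots> = 1" using S(3) nn by (simp add: sum_ennreal)
  finally show ?thesis
    unfolding rw_step_def using nn by (intro pmf_embed_pmf) auto
qed

definition rw_law :: "'v rtree \<Rightarrow> real \<Rightarrow> 'v \<Rightarrow> (nat \<Rightarrow> 'v) measure" where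
  "rw_law T lam x = markov_law (rw_step T lam) x"

definition return_prob :: "'v rtree \<Rightarrow> real \<Rightarrow> 'v \<Rightarrow> real" where
  "return_prob T lam x = measure (rw_law T lam x) {X. \<exists>n>0. X n = x}"

definition no_return_prob :: "'v rtree \<Rightarrow> real \<Rightarrow> 'v \<Rightarrow> real" where
  "no_return_prob T lam x = measure (rw_law T lam x) {X. \<forall>n>0. X n \<noteq> x}"

definition recurrent :: "'v rtree \<Rightarrow> real \<Rightarrow> bool" where
  "recurrent T lam \<longleftrightarrow> (\<forall>x\<in>verts T. return_prob T lam x = 1)"

definition transient :: "'v rtree \<Rightarrow> real \<Rightarrow> bool" where
  "transient T lam \<longleftrightarrow> (\<forall>x\<in>verts T. return_prob T lam x < 1)"

text \<open>
  A real \<open>c\<close> suffices: an infinite, locally finite tree contains a ray, so its critical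
  value is at most 1. It is unique by \<open>critical_value_unique\<close>.
\<close>

definition critical_value :: "'v rtree \<Rightarrow> real \<Rightarrow> bool" where
  "critical_value T c \<longleftrightarrow>
     0 \<le> c \<and>
     (\<forall>lam. 0 < lam \<and> lam < c \<longrightarrow> recurrent T lam) \<and>
     (\<forall>lam>c. transient T lam)"

lemma critical_value_unique:
  assumes "rooted_tree T" "critical_value T c" "critical_value T d"
  shows "c = d"
proof -
  have no: "\<not> (recurrent T lam \<and> transient T lam)" for lam
    using assms(1) by (force simp: rooted_tree_def recurrent_def transient_def)
  have "\<not> a < b" if "critical_value T a" "critical_value T b" for a b
  proof
    assume "a < b"
    then obtain l where "a < l" "l < b" using dense by blast
    then show False using that no[of l] by (auto simp: critical_value_def)
  qed
  from this[OF assms(2,3)] this[OF assms(3,2)] show ?thesis by simp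
qed

definition uniformly_transient :: "'v rtree \<Rightarrow> real \<Rightarrow> bool" where
  "uniformly_transient T c \<longleftrightarrow>
     (\<forall>lam>c. \<exists>\<alpha>>0. \<forall>v\<in>verts T. no_return_prob (subtree T v) lam v \<ge> \<alpha>)"


section \<open>Effective conductance\<close>

definition edge_conductance :: "'v rtree \<Rightarrow> real \<Rightarrow> 'v \<times> 'v \<Rightarrow> real" where
  "edge_conductance T lam e = lam ^ depth T (fst e)"

definition vertex_conductance :: "'v rtree \<Rightarrow> real \<Rightarrow> 'v \<Rightarrow> real" where
  "vertex_conductance T lam x =
     (\<Sum>e\<in>{e \<in> edges T. fst e = x \<or> snd e = x}. edge_conductance T lam e)"

definition effective_conductance :: "'v rtree \<Rightarrow> real \<Rightarrow> real" where
  "effective_conductance T lam =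
     vertex_conductance T lam (root T) * no_return_prob T lam (root T)"

end

theory Submission
  imports Defs
begin

text \<open>
  Let \<open>b(x)\<close> be the probability that the walk started at \<open>x\<close> never visits the parent of \<open>x\<close>. It
  is the decreasing limit of continuous functions \<open>b\<^sub>n\<close> of \<open>\<lambda>\<close>, given by \<open>b\<^sub>0 = 1\<close> and
  \<open>b\<^sub>n\<^sub>+\<^sub>1(x) = \<lambda>S / (1 + \<lambda>S)\<close>, where \<open>S\<close> is the sum of \<open>b\<^sub>n\<close> over the children of \<open>x\<close>, and the
  probability of no return to a root is the average of \<open>b\<close> over its children. All \<open>b\<^sub>n\<close> and \<open>b\<close>
  increase with \<open>\<lambda>\<close>, so uniform transience at some \<open>\<mu> > \<lambda>\<^sub>c\<close> bounds the child sums of \<open>b\<close> below by a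
  constant \<open>\<alpha> > 0\<close>, uniformly in the vertex and in \<open>\<lambda> \<ge> \<mu>\<close>. Then the recursion contracts \<open>b\<^sub>n / b - 1\<close>
  by the factor \<open>1 / (1 + \<mu>\<alpha>)\<close> at each step, so \<open>b\<^sub>n\<close> converges to \<open>b\<close> uniformly on \<open>[\<mu>, \<infinity>)\<close>, and
  the limit is continuous there.
\<close>

section \<open>Finite path laws and hitting probabilities of a Markov chain\<close>

text \<open>Splitting off the first step at the head of the list makes first-step analysis of
  hitting probabilities a direct computation.\<close>

primrec path_pmf :: "('v \<Rightarrow> 'v pmf) \<Rightarrow> nat \<Rightarrow> 'v \<Rightarrow> 'v list pmf" where
  "path_pmf K 0 x = return_pmf [x]"
| "path_pmf K (Suc n) x = map_pmf ((#) x) (bind_pmf (K x) (path_pmf K n))"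

lemma length_path_pmf: "ws \<in> set_pmf (path_pmf K n x) \<Longrightarrow> length ws = Suc n"
  by (induction n arbitrary: x ws) auto

text \<open>The right-hand side is the cylinder probability from \<open>markov_law_cylinder\<close>,
  so both laws agree on single finite paths.\<close>

lemma pmf_path_pmf:
  "pmf (path_pmf K n x) (map w [0..<Suc n]) =
     of_bool (w 0 = x) * (\<Prod>i<n. pmf (K (w i)) (w (Suc i)))"
proof (induction n arbitrary: x w)
  case 0
  then show ?case by (auto simp: indicator_def)
next
  case (Suc n)
  let ?ws = "map (\<lambda>i. w (Suc i)) [0..<Suc n]"
  have ws: "map w [0..<Suc (Suc n)] = w 0 # ?ws"
    by (subst upt_rec) (simp add: map_Suc_upt[symmetric] del: upt_Suc)
  show ?case
  proof (cases "w 0 = x")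
    case True
    have "pmf (path_pmf K (Suc n) x) (map w [0..<Suc (Suc n)]) =
        pmf (bind_pmf (K x) (path_pmf K n)) ?ws"
      using True unfolding ws by (simp add: pmf_map_inj' del: upt_Suc)
    also have "\<dots> = (\<integral>y. pmf (path_pmf K n y) ?ws \<partial>K x)"
      by (simp add: pmf_bind del: upt_Suc)
    also have "\<dots> = (\<integral>y. indicator {w (Suc 0)} y * (\<Prod>i<n. pmf (K (w (Suc i))) (w (Suc (Suc i)))) \<partial>K x)"
      unfolding Suc.IH by (intro Bochner_Integration.integral_cong) (auto simp: indicator_def)
    also have "\<dots> = pmf (K x) (w (Suc 0)) * (\<Prod>i<n. pmf (K (w (Suc i))) (w (Suc (Suc i))))"
      by (simp add: pmf.rep_eq)
    finally show ?thesis using True by (simp add: prod.lessThan_Suc_shift del: upt_Suc prod.lessThan_Suc)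
  next
    case False
    then have "map w [0..<Suc (Suc n)] \<notin> set_pmf (path_pmf K (Suc n) x)"
      unfolding ws by auto
    then have "pmf (path_pmf K (Suc n) x) (map w [0..<Suc (Suc n)]) = 0"
      by (simp only: set_pmf_iff not_not)
    then show ?thesis using False by simp
  qed
qed

text \<open>The support of \<open>path_pmf\<close> is countable and each path in it is a cylinder of
  the same mass under both laws. Countable additivity therefore gives one inequality for every
  event. Measurability of the event is assumed because \<open>'v\<close> is arbitrary.\<close>

lemma measure_markov_law_path:
  fixes K :: "'v \<Rightarrow> 'v pmf"
  assumes B: "{\<omega>. map \<omega> [0..<Suc n] \<in> B} \<in> sets (PiM UNIV (\<lambda>_. count_space UNIV))"
  shows "measure (markov_law K x) {\<omega>. map \<omega> [0..<Suc n] \<in> B} = measure_pmf.prob (path_pmf K n x) B"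
proof -
  let ?M = "markov_law K x" and ?p = "path_pmf K n x"
  let ?E = "\<lambda>B. {\<omega>. map \<omega> [0..<Suc n] \<in> B}"
  interpret prob_space ?M by (rule prob_space_markov_law)
  have *: "measure_pmf.prob ?p C \<le> measure ?M (?E C)" if C: "?E C \<in> sets ?M" for C
  proof -
    let ?D = "set_pmf ?p \<inter> C"
    have cyl: "?E {ws} = {\<omega>. \<forall>i\<le>n. \<omega> i = ws ! i}" if "ws \<in> ?D" for ws
    proof -
      have "length ws = Suc n" using that length_path_pmf[of ws K n x] by auto
      then show ?thesis by (auto simp: list_eq_iff_nth_eq less_Suc_eq_le simp del: upt_Suc)
    qed
    have mcyl: "{\<omega>. \<forall>i\<le>n. \<omega> i = w i} \<in> sets ?M" for w
    proof -
      have "{\<omega> \<in> space ?M. \<forall>i\<le>n. \<omega> i = w i} \<in> sets ?M" by measurable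
      then show ?thesis by simp
    qed
    have eq: "emeasure ?M (?E {ws}) = emeasure ?p {ws}" if ws: "ws \<in> ?D" for ws
    proof -
      have "ws = map ((!) ws) [0..<Suc n]"
        using ws length_path_pmf[of ws K n x] map_nth[of ws] by simp
      then have "pmf ?p ws = measure ?M (?E {ws})"
        unfolding cyl[OF ws] markov_law_cylinder by (metis pmf_path_pmf)
      then show ?thesis by (simp add: emeasure_eq_measure emeasure_pmf_single)
    qed
    have cnt: "countable ?D" by (simp add: countable_Int1)
    have "emeasure ?p C = emeasure ?p ?D"
      by (metis emeasure_Int_set_pmf Int_commute)
    also have "\<dots> = (\<integral>\<^sup>+ws. emeasure ?p {ws} \<partial>count_space ?D)"
      using cnt by (intro emeasure_countable_singleton) auto
    also have "\<dots> = (\<integral>\<^sup>+ws. emeasure ?M (?E {ws}) \<partial>count_space ?D)"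
      using eq by (intro nn_integral_cong) simp
    also have "\<dots> = emeasure ?M (\<Union>ws\<in>?D. ?E {ws})"
    proof (rule emeasure_UN_countable[symmetric])
      show "?E {ws} \<in> sets ?M" if "ws \<in> ?D" for ws
        unfolding cyl[OF that] by (rule mcyl)
      show "disjoint_family_on (\<lambda>ws. ?E {ws}) ?D"
        by (auto simp: disjoint_family_on_def)
    qed (rule cnt)
    also have "\<dots> \<le> emeasure ?M (?E C)"
      using C by (intro emeasure_mono) auto
    finally show ?thesis
      by (simp add: emeasure_eq_measure measure_pmf.emeasure_eq_measure)
  qed
  have B': "?E B \<in> sets ?M"
    using B by (simp only: sets_markov_law)
  have c: "?E (- B) = space ?M - ?E B" by auto
  have "?E (- B) \<in> sets ?M" unfolding c using B' by (rule sets.compl_sets)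
  \<comment> \<open>Both laws have total mass 1, so the inequality for the complement is the reverse
    inequality for \<open>B\<close>.\<close>
  from *[OF this] have "1 - measure_pmf.prob ?p B \<le> 1 - measure ?M (?E B)"
    unfolding c prob_compl[OF B'] using measure_pmf.prob_compl[of B ?p] by (simp add: Compl_eq_Diff_UNIV)
  with *[OF B'] show ?thesis by linarith
qed

definition hit_prob :: "('v \<Rightarrow> 'v pmf) \<Rightarrow> 'v \<Rightarrow> nat \<Rightarrow> 'v \<Rightarrow> real" where
  "hit_prob K a n x = measure_pmf.prob (path_pmf K n x) {ws. a \<in> set ws}"

lemma hit_prob_bounds: "0 \<le> hit_prob K a n x" "hit_prob K a n x \<le> 1"
  by (simp_all add: hit_prob_def)

lemma hit_prob_0: "hit_prob K a 0 x = of_bool (x = a)"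
  by (auto simp: hit_prob_def indicator_def)

lemma measure_bind_pmf:
  "measure_pmf.prob (bind_pmf p f) A = (\<integral>y. measure_pmf.prob (f y) A \<partial>p)"
proof -
  have "ennreal (measure_pmf.prob (bind_pmf p f) A) = (\<integral>\<^sup>+y. ennreal (measure_pmf.prob (f y) A) \<partial>p)"
    using emeasure_bind_pmf[of p f A] by (simp add: measure_pmf.emeasure_eq_measure)
  also have "\<dots> = ennreal (\<integral>y. measure_pmf.prob (f y) A \<partial>p)"
    by (intro nn_integral_eq_integral measure_pmf.integrable_const_bound[of _ 1]) auto
  finally show ?thesis by (simp add: integral_nonneg)
qed

lemma hit_prob_Suc:
  "hit_prob K a (Suc n) x = (if x = a then 1 else \<integral>y. hit_prob K a n y \<partial>measure_pmf (K x))"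
proof (cases "x = a")
  case True
  then have "(#) x -` {ws. a \<in> set ws} = UNIV" by auto
  then show ?thesis using True by (simp add: hit_prob_def)
next
  case False
  then have "(#) x -` {ws. a \<in> set ws} = {ws. a \<in> set ws}" by auto
  then show ?thesis using False by (simp add: hit_prob_def[abs_def] measure_bind_pmf)
qed

lemma hit_prob_self: "hit_prob K a n a = 1"
  by (cases n) (simp_all add: hit_prob_0 hit_prob_Suc)

text \<open>The laws for different \<open>n\<close> live on lists of different lengths, so the
  comparison goes through the first-step recursion instead of an inclusion of events.\<close>

lemma incseq_hit_prob: "incseq (\<lambda>n. hit_prob K a n x)"
proof (rule incseq_SucI)
  show "hit_prob K a n x \<le> hit_prob K a (Suc n) x" for n
  proof (induction n arbitrary: x)
    case 0
    then show ?case by (simp add: hit_prob_0 hit_prob_bounds hit_prob_self)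
  next
    case (Suc n)
    have i: "integrable (K x) (hit_prob K a n)" for n
      by (intro measure_pmf.integrable_const_bound[of _ 1]) (auto simp: hit_prob_bounds)
    show ?case unfolding hit_prob_Suc[of K a "Suc n"] hit_prob_Suc[of K a n x]
      using Suc by (auto intro!: integral_mono i)
  qed
qed

text \<open>The events of no return during times 1 to \<open>n + 1\<close> decrease to the event of
  no return. By first-step analysis, each is the event that the point reached at time 1 does not
  lead to \<open>a\<close> within \<open>n\<close> further steps.\<close>

lemma no_return_LIMSEQ:
  "(\<lambda>n. 1 - (\<integral>y. hit_prob K a n y \<partial>measure_pmf (K a))) \<longlonglongrightarrow> measure (markov_law K a) {X. \<forall>n>0. X n \<noteq> a}"
proof -
  let ?M = "markov_law K a"
  interpret prob_space ?M by (rule prob_space_markov_law)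
  let ?F = "\<lambda>n. {X. \<forall>i\<le>n. X (Suc i) \<noteq> a}"
  have F: "?F n \<in> sets ?M" for n
  proof -
    have "{X \<in> space ?M. \<forall>i\<le>n. X (Suc i) \<noteq> a} \<in> sets ?M" by measurable
    then show ?thesis by simp
  qed
  have m: "measure ?M (?F n) = 1 - (\<integral>y. hit_prob K a n y \<partial>measure_pmf (K a))" for n
  proof -
    \<comment> \<open>The path covers times 0 to \<open>n + 1\<close>; \<open>tl\<close> discards
      the start, which is \<open>a\<close> itself.\<close>
    have e: "?F n = {X. map X [0..<Suc (Suc n)] \<in> {ws. a \<notin> set (tl ws)}}"
      by (subst upt_rec) (auto simp: map_Suc_upt[symmetric] image_iff less_Suc_eq_le simp del: upt_Suc)
    have "measure ?M (?F n) = measure_pmf.prob (path_pmf K (Suc n) a) {ws. a \<notin> set (tl ws)}"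
      unfolding e by (intro measure_markov_law_path) (use F[of n] in \<open>simp only: e sets_markov_law\<close>)
    also have "\<dots> = measure_pmf.prob (bind_pmf (K a) (path_pmf K n)) (- {ws. a \<in> set ws})"
      by (auto intro!: arg_cong2[where f = measure] simp: vimage_def)
    also have "\<dots> = 1 - (\<integral>y. hit_prob K a n y \<partial>measure_pmf (K a))"
      using measure_pmf.prob_compl[of "{ws. a \<in> set ws}" "bind_pmf (K a) (path_pmf K n)"]
      by (simp add: Compl_eq_Diff_UNIV measure_bind_pmf hit_prob_def)
    finally show ?thesis .
  qed
  have "(\<lambda>n. measure ?M (?F n)) \<longlonglongrightarrow> measure ?M (\<Inter>n. ?F n)"
  proof (rule finite_Lim_measure_decseq)
    show "range ?F \<subseteq> sets ?M" using F by auto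
    show "decseq ?F" by (intro decseq_SucI subsetI) simp
  qed
  moreover have "(\<Inter>n. ?F n) = {X. \<forall>n>0. X n \<noteq> a}"
    by (auto simp: gr0_conv_Suc)
  ultimately show ?thesis by (simp only: m)
qed

section \<open>One-step expectations of the walk\<close>

lemma rw_step_expectation:
  fixes f :: "'v \<Rightarrow> real"
  assumes "rooted_tree T" "locally_finite T" "(p, x) \<in> edges T" "lam > 0"
  shows "(\<integral>y. f y \<partial>measure_pmf (rw_step T lam x)) =
    (f p + lam * (\<Sum>c\<in>children T x. f c)) / (1 + real (card (children T x)) * lam)"
proof -
  have x: "x \<in> verts T" "x \<noteq> root T" using assms(1,3) by (auto simp: rooted_tree_def)
  have up: "(q, x) \<in> edges T \<longleftrightarrow> q = p" for q
    using assms(1,3) x unfolding rooted_tree_def by blast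
  have pc: "p \<notin> children T x"
    using rooted_tree_no_2cycle[OF assms(1,3)] by (auto simp: children_def)
  have fin: "finite (children T x)" using assms(2) x by (simp add: locally_finite_def)
  note P = pmf_rw_step[OF assms(1,2) x(1) assms(4)]
  have "(\<integral>y. f y \<partial>measure_pmf (rw_step T lam x)) =
      (\<Sum>y\<in>insert p (children T x). f y * rw_prob T lam x y)"
    using fin x(2) up unfolding P[symmetric]
    by (intro integral_measure_pmf_real) (auto simp: set_pmf_iff P rw_prob_def Let_def split: if_splits)
  also have "\<dots> = f p / (1 + real (card (children T x)) * lam) +
      (\<Sum>y\<in>children T x. f y * (lam / (1 + real (card (children T x)) * lam)))"
    using fin pc x(2) up
    by (subst sum.insert) (auto simp: rw_prob_def Let_def intro!: sum.cong)
  also have "\<dots> = (f p + lam * (\<Sum>c\<in>children T x. f c)) / (1 + real (card (children T x)) * lam)"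
    unfolding sum_distrib_right[symmetric] by (simp add: add_divide_distrib mult.commute)
  finally show ?thesis .
qed

lemma rw_step_expectation_root:
  fixes f :: "'v \<Rightarrow> real"
  assumes "rooted_tree T" "locally_finite T" "lam > 0"
  shows "(\<integral>y. f y \<partial>measure_pmf (rw_step T lam (root T))) =
    (if children T (root T) = {} then f (root T)
     else (\<Sum>c\<in>children T (root T). f c) / real (card (children T (root T))))"
proof -
  let ?o = "root T"
  have x: "?o \<in> verts T" using assms(1) by (auto simp: rooted_tree_def)
  have fin: "finite (children T ?o)" using assms(2) x by (simp add: locally_finite_def)
  note P = pmf_rw_step[OF assms(1,2) x(1) assms(3)]
  let ?A = "if children T ?o = {} then {?o} else children T ?o"
  have "(\<integral>y. f y \<partial>measure_pmf (rw_step T lam ?o)) = (\<Sum>y\<in>?A. f y * rw_prob T lam ?o y)"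
    using fin unfolding P[symmetric]
    by (intro integral_measure_pmf_real) (auto simp: set_pmf_iff P rw_prob_def Let_def split: if_splits)
  also have "\<dots> = (if children T ?o = {} then f ?o
     else (\<Sum>c\<in>children T ?o. f c) / real (card (children T ?o)))"
    by (auto simp: rw_prob_def sum_divide_distrib intro!: sum.cong)
  finally show ?thesis .
qed

section \<open>The recursion for escape probabilities\<close>

text \<open>
  \<open>esc T lam n x\<close> is the probability that the walk started at \<open>x\<close> descends \<open>n\<close> levels before it
  visits the parent of \<open>x\<close>.
\<close>

primrec esc :: "'v rtree \<Rightarrow> real \<Rightarrow> nat \<Rightarrow> 'v \<Rightarrow> real" where
  "esc T lam 0 x = 1"
| "esc T lam (Suc n) x =
     lam * (\<Sum>c\<in>children T x. esc T lam n c) / (1 + lam * (\<Sum>c\<in>children T x. esc T lam n c))"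

text \<open>The infimum is the limit, since the sequence decreases (\<open>esc_LIMSEQ\<close>); this
  form lets bounds pass from \<open>esc\<close> to \<open>escape\<close> directly.\<close>

definition escape :: "'v rtree \<Rightarrow> real \<Rightarrow> 'v \<Rightarrow> real" where
  "escape T lam x = (INF n. esc T lam n x)"

text \<open>The recursion for \<open>esc\<close> applies this map to \<open>lam\<close> times the
  child sum, so comparisons pass from one level to the next.\<close>

lemma divide_one_plus_mono:
  fixes a b :: real
  assumes "0 \<le> a" "a \<le> b"
  shows "a / (1 + a) \<le> b / (1 + b)"
  using assms by (simp add: field_simps)

lemma esc_bounds:
  assumes "0 \<le> lam"
  shows "0 \<le> esc T lam n x" "esc T lam n x \<le> 1"
proof -
  have nn: "0 \<le> esc T lam n x" for n x
    using assms by (induction n arbitrary: x) (auto intro!: divide_nonneg_nonneg mult_nonneg_nonneg sum_nonneg add_nonneg_nonneg)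
  then show "0 \<le> esc T lam n x" .
  show "esc T lam n x \<le> 1"
  proof (cases n)
    case (Suc m)
    have "0 \<le> lam * (\<Sum>c\<in>children T x. esc T lam m c)"
      using assms nn by (intro mult_nonneg_nonneg sum_nonneg) auto
    then show ?thesis by (simp add: Suc)
  qed simp
qed

text \<open>The recursion is monotone and starts from the largest possible value 1.\<close>

lemma decseq_esc:
  assumes "0 \<le> lam"
  shows "decseq (\<lambda>n. esc T lam n x)"
proof (rule decseq_SucI)
  show "esc T lam (Suc n) x \<le> esc T lam n x" for n
  proof (induction n arbitrary: x)
    case 0
    show ?case using esc_bounds(2)[OF assms] by (simp only: esc.simps(1))
  next
    case (Suc n)
    show ?case
      unfolding esc.simps(2)[of _ _ "Suc n"] esc.simps(2)[of _ _ n x]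
      using assms
      by (intro divide_one_plus_mono mult_left_mono sum_mono mult_nonneg_nonneg sum_nonneg Suc.IH esc_bounds) auto
  qed
qed

lemma esc_mono:
  assumes "0 \<le> l" "l \<le> m"
  shows "esc T l n x \<le> esc T m n x"
proof (induction n arbitrary: x)
  case (Suc n)
  show ?case unfolding esc.simps
    using assms
    by (intro divide_one_plus_mono mult_mono sum_mono mult_nonneg_nonneg sum_nonneg Suc.IH esc_bounds) auto
qed simp

lemma continuous_on_esc: "continuous_on {0..} (\<lambda>lam. esc T lam n x)"
proof (induction n arbitrary: x)
  case (Suc n)
  have "1 + lam * (\<Sum>c\<in>children T x. esc T lam n c) \<noteq> 0" if "lam \<in> {0..}" for lam
  proof -
    have "0 \<le> lam * (\<Sum>c\<in>children T x. esc T lam n c)"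
      using that esc_bounds(1) by (intro mult_nonneg_nonneg sum_nonneg) auto
    then show ?thesis by linarith
  qed
  then show ?case unfolding esc.simps by (intro continuous_intros Suc.IH) auto
qed simp

lemma bdd_below_esc: "0 \<le> lam \<Longrightarrow> bdd_below (range (\<lambda>n. esc T lam n x))"
  by (auto intro!: bdd_belowI[of _ 0] esc_bounds)

lemma esc_LIMSEQ:
  assumes "0 \<le> lam"
  shows "(\<lambda>n. esc T lam n x) \<longlonglongrightarrow> escape T lam x"
  unfolding escape_def using assms by (intro LIMSEQ_decseq_INF bdd_below_esc decseq_esc)

lemma escape_le_esc: "0 \<le> lam \<Longrightarrow> escape T lam x \<le> esc T lam n x"
  unfolding escape_def by (intro cINF_lower bdd_below_esc) auto

lemma escape_bounds:
  assumes "0 \<le> lam"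
  shows "0 \<le> escape T lam x" "escape T lam x \<le> 1"
  using esc_bounds[OF assms] escape_le_esc[OF assms, of T x 0]
  by (auto simp: escape_def intro!: cINF_greatest)

lemma escape_mono:
  assumes "0 \<le> l" "l \<le> m"
  shows "escape T l x \<le> escape T m x"
  unfolding escape_def[of T m]
  using assms escape_le_esc[of l T x] esc_mono[of l m T _ x] by (intro cINF_greatest) (auto intro: order_trans)

lemma escape_eq:
  assumes "0 \<le> lam"
  shows "escape T lam x =
    lam * (\<Sum>c\<in>children T x. escape T lam c) / (1 + lam * (\<Sum>c\<in>children T x. escape T lam c))"
proof -
  have "0 \<le> lam * (\<Sum>c\<in>children T x. escape T lam c)"
    using assms by (intro mult_nonneg_nonneg sum_nonneg escape_bounds) auto
  then have "(\<lambda>n. esc T lam (Suc n) x) \<longlonglongrightarrow>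
      lam * (\<Sum>c\<in>children T x. escape T lam c) / (1 + lam * (\<Sum>c\<in>children T x. escape T lam c))"
    unfolding esc.simps by (intro tendsto_intros esc_LIMSEQ assms) auto
  with LIMSEQ_Suc[OF esc_LIMSEQ[OF assms]] show ?thesis by (rule LIMSEQ_unique)
qed

text \<open>This recovers the weight of a parent from that of its child, which is what makes the
  weight below harmonic.\<close>

lemma one_minus_escape:
  assumes "0 \<le> lam"
  shows "(1 - escape T lam x) * (1 + lam * (\<Sum>c\<in>children T x. escape T lam c)) = 1"
proof -
  have "0 \<le> lam * (\<Sum>c\<in>children T x. escape T lam c)"
    using assms by (intro mult_nonneg_nonneg sum_nonneg escape_bounds) auto
  then show ?thesis by (subst escape_eq[OF assms]) (simp add: field_simps)
qed

section \<open>Escape probabilities as limits of hitting probabilities\<close>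

text \<open>
  The weight of \<open>x\<close> is the product of \<open>1 - escape\<close> along the path from the root to \<open>x\<close>, which is
  harmonic off the root.
\<close>

inductive ret_weight :: "'v rtree \<Rightarrow> real \<Rightarrow> 'v \<Rightarrow> real \<Rightarrow> bool" for T lam where
  root: "ret_weight T lam (root T) 1"
| child: "ret_weight T lam x g \<Longrightarrow> (x, y) \<in> edges T \<Longrightarrow>
    ret_weight T lam y (g * (1 - escape T lam y))"

lemma ret_weight_nonneg: "ret_weight T lam x g \<Longrightarrow> 0 \<le> lam \<Longrightarrow> 0 \<le> g"
  by (induction rule: ret_weight.induct) (auto simp: escape_bounds)

text \<open>The weight is nonnegative, equals 1 at the root and is harmonic elsewhere. The hitting
  probabilities start from the indicator of the root and evolve by the same averaging, so they never
  exceed it.\<close>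

lemma hit_prob_le_ret_weight:
  assumes T: "rooted_tree T" "locally_finite T" and l: "lam > 0"
  shows "ret_weight T lam x g \<Longrightarrow> hit_prob (rw_step T lam) (root T) n x \<le> g"
proof (induction n arbitrary: x g)
  case 0
  from 0 show ?case
  proof cases
    case (child y h)
    then have "x \<noteq> root T" using T by (auto simp: rooted_tree_def)
    then show ?thesis using 0 l by (simp add: hit_prob_0 ret_weight_nonneg)
  qed (simp add: hit_prob_0)
next
  case (Suc n)
  let ?H = "hit_prob (rw_step T lam) (root T)"
  from Suc.prems show ?case
  proof cases
    case (child p h)
    let ?S = "\<Sum>c\<in>children T x. escape T lam c" and ?k = "real (card (children T x))"
    have "x \<noteq> root T" using T child by (auto simp: rooted_tree_def)
    then have "?H (Suc n) x = (?H n p + lam * (\<Sum>c\<in>children T x. ?H n c)) / (1 + ?k * lam)"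
      by (simp add: hit_prob_Suc rw_step_expectation[OF T child(3) l])
    also have "\<dots> \<le> (h + lam * (\<Sum>c\<in>children T x. g * (1 - escape T lam c))) / (1 + ?k * lam)"
      using l
      by (intro divide_right_mono add_mono mult_left_mono sum_mono Suc.IH
          ret_weight.child[OF Suc.prems]) (auto simp: children_def child(2))
    also have "(\<Sum>c\<in>children T x. g * (1 - escape T lam c)) = g * (?k - ?S)"
      by (simp add: sum_distrib_left[symmetric] sum_subtractf)
    \<comment> \<open>Here \<open>h\<close> is the weight of the parent and
      \<open>g = h * (1 - escape T lam x)\<close>, which \<open>one_minus_escape\<close>
      inverts.\<close>
    also have "h = g * (1 + lam * ?S)"
      using one_minus_escape[of lam T x] l child(1) by (simp add: mult.assoc)
    also have "g * (1 + lam * ?S) + lam * (g * (?k - ?S)) = g * (1 + ?k * lam)"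
      by (simp add: algebra_simps)
    also have "\<dots> / (1 + ?k * lam) = g"
      using l add_pos_nonneg[of 1 "?k * lam"] by simp
    finally show ?thesis .
  qed (simp add: hit_prob_bounds)
qed

text \<open>The factor \<open>1 - esc T lam n x\<close> is the probability of visiting the parent
  before descending \<open>n\<close> levels, and a nonnegative superharmonic function at
  \<open>x\<close> is at least its value at the parent times this probability. The induction bounds
  the values at the children of \<open>x\<close> by \<open>h x\<close> in the same way and then
  solves for \<open>h x\<close>.\<close>

lemma superharmonic_ge_esc:
  assumes T: "rooted_tree T" "locally_finite T" and l: "lam > 0"
  and h: "\<And>x. 0 \<le> h x"
  and har: "\<And>p x. (p, x) \<in> edges T \<Longrightarrow> 
     (h p + lam * (\<Sum>c\<in>children T x. h c)) / (1 + real (card (children T x)) * lam) \<le> h x"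
  shows "(p, x) \<in> edges T \<Longrightarrow> (1 - esc T lam n x) * h p \<le> h x"
proof (induction n arbitrary: p x)
  case 0
  then show ?case using h by simp
next
  case (Suc n)
  let ?S = "\<Sum>c\<in>children T x. esc T lam n c" and ?k = "real (card (children T x))"
  have S: "0 \<le> lam * ?S" using l by (intro mult_nonneg_nonneg sum_nonneg esc_bounds) auto
  have kp: "0 < 1 + ?k * lam" using l by (simp add: add_pos_nonneg)
  have "h p + lam * ((?k - ?S) * h x) = h p + lam * (\<Sum>c\<in>children T x. (1 - esc T lam n c) * h x)"
    by (simp add: sum_distrib_right[symmetric] sum_subtractf)
  also have "\<dots> \<le> h p + lam * (\<Sum>c\<in>children T x. h c)"
    using l by (intro add_left_mono mult_left_mono sum_mono Suc.IH) (auto simp: children_def)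
  also have "\<dots> \<le> h x * (1 + ?k * lam)"
    using har[OF Suc.prems] kp by (simp add: pos_divide_le_eq)
  finally have "h p \<le> h x * (1 + lam * ?S)" by (simp add: algebra_simps)
  moreover have "1 - esc T lam (Suc n) x = 1 / (1 + lam * ?S)"
    using S by (simp add: field_simps)
  ultimately show ?case using S by (simp add: pos_divide_le_eq)
qed

text \<open>The weight of a child of the root is \<open>1 - escape\<close>, which bounds the limit
  from above. For the lower bound, the limit is itself harmonic off the root with value 1 there, so
  \<open>superharmonic_ge_esc\<close> applies to it.\<close>

lemma hit_prob_LIMSEQ_escape:
  assumes T: "rooted_tree T" "locally_finite T" and l: "lam > 0" and c: "c \<in> children T (root T)"
  shows "(\<lambda>n. hit_prob (rw_step T lam) (root T) n c) \<longlonglongrightarrow> 1 - escape T lam c"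
proof -
  let ?H = "hit_prob (rw_step T lam) (root T)"
  define h where "h x = (SUP n. ?H n x)" for x
  have bdd: "bdd_above (range (\<lambda>n. ?H n x))" for x
    by (auto intro!: bdd_aboveI[of _ 1] hit_prob_bounds)
  have lim: "(\<lambda>n. ?H n x) \<longlonglongrightarrow> h x" for x
    unfolding h_def by (intro LIMSEQ_incseq_SUP bdd incseq_hit_prob)
  have har: "(h p + lam * (\<Sum>c\<in>children T x. h c)) / (1 + real (card (children T x)) * lam) = h x"
    if e: "(p, x) \<in> edges T" for p x
  proof (rule LIMSEQ_unique)
    have "x \<noteq> root T" using T e by (auto simp: rooted_tree_def)
    then have "?H (Suc n) x = (?H n p + lam * (\<Sum>c\<in>children T x. ?H n c)) / (1 + real (card (children T x)) * lam)" for n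
      by (simp add: hit_prob_Suc rw_step_expectation[OF T e l])
    with LIMSEQ_Suc[OF lim[of x]]
    show "(\<lambda>n. (?H n p + lam * (\<Sum>c\<in>children T x. ?H n c)) / (1 + real (card (children T x)) * lam)) \<longlonglongrightarrow> h x"
      by simp
    have "1 + real (card (children T x)) * lam > 0" using l by (simp add: add_pos_nonneg)
    then show "(\<lambda>n. (?H n p + lam * (\<Sum>c\<in>children T x. ?H n c)) / (1 + real (card (children T x)) * lam)) \<longlonglongrightarrow>
       (h p + lam * (\<Sum>c\<in>children T x. h c)) / (1 + real (card (children T x)) * lam)"
      by (intro tendsto_intros lim) auto
  qed
  have nn: "0 \<le> h x" for x
    by (rule LIMSEQ_le_const[OF lim]) (simp add: hit_prob_bounds)
  have "ret_weight T lam c (1 * (1 - escape T lam c))"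
    by (rule ret_weight.child[OF ret_weight.root])
      (use c in \<open>simp add: children_def\<close>)
  then have "?H n c \<le> 1 - escape T lam c" for n
    using hit_prob_le_ret_weight[OF T l] by fastforce
  then have "h c \<le> 1 - escape T lam c"
    using LIMSEQ_le_const2[OF lim] by blast
  moreover have "1 - escape T lam c \<le> h c"
  proof (rule LIMSEQ_le_const2)
    show "(\<lambda>n. 1 - esc T lam n c) \<longlonglongrightarrow> 1 - escape T lam c"
      using l by (intro tendsto_intros esc_LIMSEQ) auto
    have "h (root T) = 1"
      using LIMSEQ_unique[OF lim[of "root T"]] by (simp add: hit_prob_self)
    then have "1 - esc T lam n c \<le> h c" for n
      using superharmonic_ge_esc[where h = h and n = n, OF T l nn eq_refl[OF har], of "root T" c] c by (simp add: children_def)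
    then show "\<exists>N. \<forall>n\<ge>N. 1 - esc T lam n c \<le> h c" by blast
  qed
  ultimately show ?thesis using lim[of c] by simp
qed

text \<open>At a childless root both sides vanish, by \<open>x / 0 = 0\<close>.\<close>

lemma no_return_prob_root:
  assumes T: "rooted_tree T" "locally_finite T" and l: "lam > 0"
  shows "no_return_prob T lam (root T) =
    (\<Sum>c\<in>children T (root T). escape T lam c) / real (card (children T (root T)))"
proof -
  let ?o = "root T" and ?K = "rw_step T lam"
  let ?k = "real (card (children T ?o))"
  have fin: "finite (children T ?o)" using T by (simp add: locally_finite_def rooted_tree_def)
  have "(\<lambda>n. 1 - (\<integral>y. hit_prob ?K ?o n y \<partial>measure_pmf (?K ?o))) \<longlonglongrightarrow>
    (\<Sum>c\<in>children T ?o. escape T lam c) / ?k"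
  proof (cases "children T ?o = {}")
    case True
    then show ?thesis by (simp add: rw_step_expectation_root[OF T l] hit_prob_self)
  next
    case False
    then have k: "?k > 0" using fin by (simp add: card_gt_0_iff)
    have "(\<lambda>n. 1 - (\<Sum>c\<in>children T ?o. hit_prob ?K ?o n c) / ?k) \<longlonglongrightarrow>
        1 - (\<Sum>c\<in>children T ?o. 1 - escape T lam c) / ?k"
      using k by (intro tendsto_intros hit_prob_LIMSEQ_escape T l) auto
    also have "1 - (\<Sum>c\<in>children T ?o. 1 - escape T lam c) / ?k = (\<Sum>c\<in>children T ?o. escape T lam c) / ?k"
      using k by (simp add: sum_subtractf field_simps)
    finally show ?thesis using False by (simp add: rw_step_expectation_root[OF T l])
  qed
  with no_return_LIMSEQ[of ?K ?o] show ?thesis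
    unfolding no_return_prob_def rw_law_def by (rule LIMSEQ_unique)
qed

section \<open>Subtrees and escape probabilities in them\<close>

text \<open>A cycle through a vertex passes through its unique parent, hence could be pushed up to
  the root, which has no incoming edge. Consequently no descendant of \<open>v\<close> is a parent
  of \<open>v\<close>, so \<open>v\<close> can serve as the root of
  \<open>subtree T v\<close>.\<close>

lemma rooted_tree_acyclic:
  assumes T: "rooted_tree T" and z: "z \<in> verts T"
  shows "(z, z) \<notin> (edges T)\<^sup>+"
proof -
  have "(root T, z) \<in> (edges T)\<^sup>*" using T z by (simp add: rooted_tree_def)
  then show ?thesis
  proof (induction rule: rtrancl_induct)
    case base
    show ?case using T by (auto simp: rooted_tree_def elim: tranclE)
  next
    case (step u w)
    show ?case
    proof
      assume "(w, w) \<in> (edges T)\<^sup>+"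
      then obtain u' where u': "(w, u') \<in> (edges T)\<^sup>*" "(u', w) \<in> edges T"
        by (meson tranclD2)
      have "w \<in> verts T - {root T}" using T step.hyps(2) by (auto simp: rooted_tree_def)
      then have "\<exists>!p. (p, w) \<in> edges T" using T by (simp add: rooted_tree_def)
      then have "u' = u" using u' step.hyps by blast
      then have "(u, u) \<in> (edges T)\<^sup>+" using step.hyps(2) u'(1) by (meson rtrancl_into_trancl2)
      then show False using step.IH by contradiction
    qed
  qed
qed

lemma descendants_verts:
  assumes "rooted_tree T" "v \<in> verts T" "x \<in> descendants T v"
  shows "x \<in> verts T"
proof -
  have "(v, x) \<in> (edges T)\<^sup>*" using assms by (simp add: descendants_def)
  then show ?thesis using assms by (induction rule: rtrancl_induct) (auto simp: rooted_tree_def)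
qed

lemma descendants_step: "x \<in> descendants T v \<Longrightarrow> (x, y) \<in> edges T \<Longrightarrow> y \<in> descendants T v"
  by (auto simp: descendants_def)

lemma children_subtree: "x \<in> descendants T v \<Longrightarrow> children (subtree T v) x = children T x"
  by (auto simp: children_def subtree_def intro: descendants_step)

lemma rooted_tree_subtree:
  assumes T: "rooted_tree T" and v: "v \<in> verts T"
  shows "rooted_tree (subtree T v)"
  unfolding rooted_tree_def
proof (intro conjI ballI allI)
  show "root (subtree T v) \<in> verts (subtree T v)" by (simp add: subtree_def descendants_def)
  show "edges (subtree T v) \<subseteq> verts (subtree T v) \<times> verts (subtree T v)"
    by (auto simp: subtree_def)
  show "(x, root (subtree T v)) \<notin> edges (subtree T v)" for x
    using rooted_tree_acyclic[OF T v]
    by (auto simp: subtree_def descendants_def dest: rtrancl_into_trancl1)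
  show "\<exists>!x. (x, y) \<in> edges (subtree T v)" if y: "y \<in> verts (subtree T v) - {root (subtree T v)}" for y
  proof -
    have vy: "(v, y) \<in> (edges T)\<^sup>*" "y \<noteq> v" using y by (auto simp: subtree_def descendants_def)
    then obtain x where x: "(v, x) \<in> (edges T)\<^sup>*" "(x, y) \<in> edges T" by (metis rtranclE)
    have "y \<in> verts T - {root T}" using T x(2) by (auto simp: rooted_tree_def)
    then have "\<exists>!p. (p, y) \<in> edges T" using T by (simp add: rooted_tree_def)
    then show ?thesis using x vy by (auto simp: subtree_def descendants_def)
  qed
  show "(root (subtree T v), y) \<in> (edges (subtree T v))\<^sup>*" if "y \<in> verts (subtree T v)" for y
  proof -
    have "(v, y) \<in> (edges T)\<^sup>*" using that by (simp add: subtree_def descendants_def)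
    then have "(v, y) \<in> (edges (subtree T v))\<^sup>*"
    proof (induction rule: rtrancl_induct)
      case (step y z)
      then have "(y, z) \<in> edges (subtree T v)" by (auto simp: subtree_def descendants_def)
      with step.IH show ?case by (rule rtrancl_into_rtrancl)
    qed simp
    then show ?thesis by (simp add: subtree_def)
  qed
qed

lemma locally_finite_subtree:
  assumes "rooted_tree T" "v \<in> verts T" "locally_finite T"
  shows "locally_finite (subtree T v)"
  using assms descendants_verts[OF assms(1,2)]
  by (auto simp: locally_finite_def children_subtree subtree_def[of T v, THEN arg_cong[of _ _ verts]])

lemma esc_subtree: "x \<in> descendants T v \<Longrightarrow> esc (subtree T v) lam n x = esc T lam n x"
proof (induction n arbitrary: x)
  case (Suc n)
  have "(\<Sum>c\<in>children T x. esc (subtree T v) lam n c) = (\<Sum>c\<in>children T x. esc T lam n c)"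
    using Suc by (intro sum.cong) (auto simp: children_def intro: descendants_step)
  then show ?case using Suc.prems by (simp add: children_subtree)
qed simp

text \<open>The value of \<open>esc\<close> at a vertex depends only on its descendants. This turns
  uniform transience into a lower bound on averages of the single function
  \<open>escape T lam\<close>.\<close>

lemma no_return_prob_subtree:
  assumes T: "rooted_tree T" "locally_finite T" and l: "lam > 0" and v: "v \<in> verts T"
  shows "no_return_prob (subtree T v) lam v =
    (\<Sum>c\<in>children T v. escape T lam c) / real (card (children T v))"
proof -
  have r: "root (subtree T v) = v" by (simp add: subtree_def)
  have v': "v \<in> descendants T v" by (simp add: descendants_def)
  have "escape (subtree T v) lam c = escape T lam c" if "c \<in> children T v" for c
  proof -
    have "c \<in> descendants T v" using that descendants_step[OF v'] by (simp add: children_def)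
    then show ?thesis by (simp add: escape_def esc_subtree)
  qed
  then show ?thesis
    using no_return_prob_root[OF rooted_tree_subtree[OF T(1) v] locally_finite_subtree[OF T(1) v T(2)] l]
    by (simp add: r children_subtree[OF v'])
qed

section \<open>Uniform convergence and continuity\<close>

text \<open>
  With \<open>s\<close> the sum of \<open>lam * escape\<close> over the children, an upper bound \<open>r\<close> for the ratio \<open>esc / escape\<close>
  on one level improves on the next to \<open>r (1 + s) / (1 + r s) = 1 + (r - 1) / (1 + r s)\<close>, and
  \<open>s \<ge> m a\<close>.
\<close>

lemma esc_le_escape:
  assumes l: "0 \<le> m" "m \<le> lam" and a: "0 < a" "0 < m"
    and S: "\<And>x. x \<in> V \<Longrightarrow> a \<le> (\<Sum>c\<in>children T x. escape T m c)"
    and V: "\<And>x. x \<in> V \<Longrightarrow> children T x \<subseteq> V" and x: "x \<in> V"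
  shows "esc T lam n x \<le> (1 + (1 / (1 + m * a)) ^ n / (1 - 1 / (1 + m * a))) * escape T lam x"
proof -
  define rho where "rho = 1 / (1 + m * a)"
  have ma: "0 < m * a" using a by simp
  then have rho: "0 < rho" "rho < 1" by (auto simp: rho_def)
  let ?S = "\<lambda>x. \<Sum>c\<in>children T x. escape T lam c"
  have l0: "0 \<le> lam" using l by simp
  \<comment> \<open>Monotonicity of \<open>escape\<close> in the parameter carries the bound from
    \<open>m\<close> to every \<open>lam\<close> above it.\<close>
  have S': "m * a \<le> lam * ?S x" if "x \<in> V" for x
  proof -
    have "a \<le> ?S x" using S[OF that] sum_mono[of "children T x" "escape T m" "escape T lam"] escape_mono[OF l]
      by (meson order_trans)
    then show ?thesis using l a by (intro mult_mono) auto
  qed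
  have "esc T lam n x \<le> (1 + rho ^ n / (1 - rho)) * escape T lam x"
    using x
  proof (induction n arbitrary: x)
    case 0
    \<comment> \<open>Since \<open>1 - rho\<close> is the value of \<open>t / (1 + t)\<close> at
      \<open>t = m * a\<close>, it bounds \<open>escape\<close> below. The initial ratio is thus at
      most \<open>1 / (1 - rho)\<close>, which explains this constant in the claim.\<close>
    have "1 - rho \<le> escape T lam x"
    proof -
      have "m * a / (1 + m * a) \<le> escape T lam x"
        unfolding escape_eq[OF l0, of T x] using ma S'[OF 0] by (intro divide_one_plus_mono) auto
      moreover have "1 - rho = m * a / (1 + m * a)" using ma by (simp add: rho_def field_simps)
      ultimately show ?thesis by simp
    qed
    then have "1 \<le> escape T lam x / (1 - rho)" using rho by (simp add: pos_le_divide_eq)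
    then show ?case using escape_bounds(1)[OF l0, of T x] by (simp add: algebra_simps)
  next
    case (Suc n)
    define r where "r = 1 + rho ^ n / (1 - rho)"
    define s where "s = lam * ?S x"
    have r: "1 \<le> r" using rho by (simp add: r_def)
    have s: "m * a \<le> s" "0 < s" using S'[OF Suc.prems] ma by (auto simp: s_def)
    have "lam * (\<Sum>c\<in>children T x. esc T lam n c) \<le> lam * (\<Sum>c\<in>children T x. r * escape T lam c)"
      using l0 V[OF Suc.prems] by (intro mult_left_mono sum_mono) (auto simp: r_def intro!: Suc.IH)
    also have "\<dots> = r * s" by (simp add: s_def sum_distrib_left mult_ac)
    finally have "esc T lam (Suc n) x \<le> r * s / (1 + r * s)"
      unfolding esc.simps using l0
      by (intro divide_one_plus_mono) (auto intro!: mult_nonneg_nonneg sum_nonneg esc_bounds)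
    also have "\<dots> = (1 + (r - 1) * (1 / (1 + r * s))) * (s / (1 + s))"
    proof -
      have pos: "1 + r * s \<noteq> 0" "1 + s \<noteq> 0"
        using r s add_pos_nonneg[of 1 "r * s"] by auto
      have "1 + (r - 1) * (1 / (1 + r * s)) = r * (1 + s) / (1 + r * s)"
        using pos(1) by (simp add: field_simps)
      then show ?thesis using pos(2) by simp
    qed
    \<comment> \<open>From \<open>r \<ge> 1\<close> and \<open>s \<ge> m * a\<close> follows
      \<open>r * s \<ge> m * a\<close>, so the excess \<open>r - 1\<close> shrinks at least by the
      factor \<open>rho\<close>.\<close>
    also have "\<dots> \<le> (1 + (r - 1) * rho) * (s / (1 + s))"
    proof -
      have "m * a \<le> r * s" using s r mult_mono[of 1 r "m * a" s] ma by simp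
      then have "1 / (1 + r * s) \<le> rho" unfolding rho_def using ma by (intro divide_left_mono) auto
      then show ?thesis using r s by (intro mult_right_mono add_left_mono mult_left_mono) auto
    qed
    also have "s / (1 + s) = escape T lam x" unfolding s_def by (rule escape_eq[OF l0, symmetric])
    also have "1 + (r - 1) * rho = 1 + rho ^ Suc n / (1 - rho)" by (simp add: r_def)
    finally show ?case .
  qed
  then show ?thesis by (simp add: rho_def)
qed

text \<open>As \<open>escape\<close> is at most 1, the relative error bound of
  \<open>esc_le_escape\<close> is also an absolute one. It does not depend on \<open>lam\<close>, so
  the continuous functions \<open>esc\<close> converge uniformly.\<close>

lemma continuous_on_escape:
  assumes a: "0 < a" "0 < m"
    and S: "\<And>x. x \<in> V \<Longrightarrow> a \<le> (\<Sum>c\<in>children T x. escape T m c)"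
    and V: "\<And>x. x \<in> V \<Longrightarrow> children T x \<subseteq> V" and x: "x \<in> V"
  shows "continuous_on {m..} (\<lambda>lam. escape T lam x)"
proof (rule uniform_limit_theorem)
  define rho where "rho = 1 / (1 + m * a)"
  have "0 < m * a" using a by simp
  then have rho: "0 < rho" "rho < 1" by (auto simp: rho_def)
  show "\<forall>\<^sub>F n in sequentially. continuous_on {m..} (\<lambda>lam. esc T lam n x)"
    using a by (intro always_eventually allI continuous_on_subset[OF continuous_on_esc]) auto
  have "(\<lambda>n. rho ^ n / (1 - rho)) \<longlonglongrightarrow> 0 / (1 - rho)"
    using rho by (intro tendsto_intros LIMSEQ_power_zero) auto
  then have lim: "(\<lambda>n. rho ^ n / (1 - rho)) \<longlonglongrightarrow> 0" by simp
  show "uniform_limit {m..} (\<lambda>n lam. esc T lam n x) (\<lambda>lam. escape T lam x) sequentially"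
  proof (rule uniform_limitI)
    fix e :: real assume "0 < e"
    then have "\<forall>\<^sub>F n in sequentially. rho ^ n / (1 - rho) < e"
      using lim by (rule order_tendstoD(2)[rotated])
    then show "\<forall>\<^sub>F n in sequentially. \<forall>lam\<in>{m..}. dist (esc T lam n x) (escape T lam x) < e"
    proof (eventually_elim, intro ballI)
      fix n lam assume n: "rho ^ n / (1 - rho) < e" and lam: "lam \<in> {m..}"
      have l0: "0 \<le> lam" using lam a by simp
      have "esc T lam n x \<le> (1 + rho ^ n / (1 - rho)) * escape T lam x"
        unfolding rho_def using lam a by (intro esc_le_escape[OF _ _ a S V x]) auto
      then have "esc T lam n x - escape T lam x \<le> rho ^ n / (1 - rho) * escape T lam x"
        by (simp add: algebra_simps)
      also have "\<dots> \<le> rho ^ n / (1 - rho)"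
        using rho escape_bounds[OF l0] by (intro mult_right_le_one_le) auto
      finally show "dist (esc T lam n x) (escape T lam x) < e"
        using n escape_le_esc[OF l0, of T x n] by (simp add: dist_real_def)
    qed
  qed
qed simp

theorem theorem36:
  fixes T :: "'v rtree" and lam\<^sub>c :: real
  assumes "rooted_tree T"
    and "infinite (verts T)"
    and "locally_finite T"
    and "critical_value T lam\<^sub>c"
    and "uniformly_transient T lam\<^sub>c"
  shows "\<forall>lam\<in>{lam\<^sub>c<..}. continuous (at_left lam) (effective_conductance T)"
proof
  fix lam assume "lam \<in> {lam\<^sub>c<..}"
  \<comment> \<open>Choosing \<open>m\<close> strictly below \<open>lam\<close> makes
    \<open>lam\<close> an interior point of the half-line on which continuity is shown.\<close>
  then obtain m where m: "lam\<^sub>c < m" "m < lam" using dense by auto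
  have c0: "0 \<le> lam\<^sub>c" using assms(4) by (simp add: critical_value_def)
  then have m0: "0 < m" using m by simp
  obtain a where a: "0 < a" "\<And>v. v \<in> verts T \<Longrightarrow> a \<le> no_return_prob (subtree T v) m v"
    using assms(5) m(1) unfolding uniformly_transient_def by blast
  have S: "a \<le> (\<Sum>c\<in>children T x. escape T m c)" if x: "x \<in> verts T" for x
  proof -
    let ?s = "\<Sum>c\<in>children T x. escape T m c" and ?k = "real (card (children T x))"
    have *: "a \<le> ?s / ?k"
      using a(2)[OF x] no_return_prob_subtree[OF assms(1,3) m0 x] by simp
    \<comment> \<open>A quotient by 0 is 0, so a positive lower bound on the average forces at least
      one child; then the sum dominates the average.\<close>
    then have "?k \<noteq> 0" using a(1) by (intro notI) simp
    then have "1 \<le> ?k" by simp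
    moreover have "0 \<le> ?s" using m0 by (intro sum_nonneg escape_bounds) auto
    ultimately have "?s / ?k \<le> ?s" using divide_left_mono[of 1 ?k ?s] by simp
    with * show ?thesis by simp
  qed
  have V: "children T x \<subseteq> verts T" for x
    using assms(1) by (auto simp: rooted_tree_def children_def)
  let ?f = "\<lambda>lam. vertex_conductance T lam (root T) *
    ((\<Sum>c\<in>children T (root T). escape T lam c) / real (card (children T (root T))))"
  \<comment> \<open>The vertex conductance is a sum of powers of \<open>lam\<close> over a fixed set
    of edges, hence continuous.\<close>
  have cont: "continuous_on {m..} ?f"
    unfolding vertex_conductance_def edge_conductance_def divide_inverse
    using V by (intro continuous_intros continuous_on_escape[OF a(1) m0 S V]) auto
  have eq: "?f l = effective_conductance T l" if "l \<in> {m..}" for l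
    using no_return_prob_root[OF assms(1,3), of l] that m0 by (simp add: effective_conductance_def)
  \<comment> \<open>On an open half-line, continuity on the set is continuity at each point, and
    left continuity follows by restriction.\<close>
  have "continuous_on {m<..} (effective_conductance T)"
    by (rule continuous_on_subset[OF continuous_on_eq[OF cont eq]]) auto
  then have "isCont (effective_conductance T) lam"
    using m(2) by (simp add: continuous_on_eq_continuous_at)
  then show "continuous (at_left lam) (effective_conductance T)"
    by (rule continuous_at_imp_continuous_within)
qed

end
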